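(* Let $c\in[0,1)$ and let $f:\mathbb{R}\to\mathbb{R}$ be continuous with $tf(t)\ge 0$ for all $t\in\mathbb{R}$. Suppose there exist a real number $a\le 1$ and a (sufficiently large) number $t_0>0$ such that $|f(t)|\le a|t|$ for all $|t|\ge t_0$. Suppose also that there exist $\alpha_1,\alpha_2\in(0,\infty)$ such that $$\liminf_{t\to 0^-}\frac{f(t)}{t}\ge\alpha_1\quad\text{and}\quad \liminf_{t\to 0^+}\frac{f(t)}{t}\ge\alpha_2 .$$ If $$(1-\sqrt{1-c})^{2}<\alpha_i<(1+\sqrt{1-c})^{2}\quad\text{for } i=1,2,$$ then the difference equation $$x_{n+1}=cx_n+f(x_n-x_{n-1}),\qquad n=1,2,\ldots,$$ is oscillatory.
   Context: A solution of the difference equation is a real sequence $\{x_n\}_{n\ge 0}$ satisfying it for all $n\ge 1$, with arbitrary real initial values $x_0,x_1$. The equation is called oscillatory if each of its solutions is neither eventually negative nor eventually positive, where a sequence is eventually positive (resp. negative) if $x_n>0$ (resp. $x_n<0$) for all sufficiently large $n$. The one-sided lower limits are allowed to equal $+\infty$. *)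

theory Defs
  imports Complex_Main "HOL-Library.Extended_Real" "HOL-Library.Liminf_Limsup"
begin

definition solution :: "real \<Rightarrow> (real \<Rightarrow> real) \<Rightarrow> (nat \<Rightarrow> real) \<Rightarrow> bool" where
  "solution c f x \<longleftrightarrow> (\<forall>n\<ge>1. x (n + 1) = c * x n + f (x n - x (n - 1)))"

definition eventually_positive :: "(nat \<Rightarrow> real) \<Rightarrow> bool" where
  "eventually_positive x \<longleftrightarrow> (\<forall>\<^sub>F n in sequentially. x n > 0)"

definition eventually_negative :: "(nat \<Rightarrow> real) \<Rightarrow> bool" where
  "eventually_negative x \<longleftrightarrow> (\<forall>\<^sub>F n in sequentially. x n < 0)"

definition oscillatory_equation :: "real \<Rightarrow> (real \<Rightarrow> real) \<Rightarrow> bool" where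
  "oscillatory_equation c f \<longleftrightarrow>
     (\<forall>x. solution c f x \<longrightarrow> \<not> eventually_negative x \<and> \<not> eventually_positive x)"

end

theory Submission
  imports Defs
begin

text \<open>
  An eventually negative solution becomes an eventually positive one under \<open>x \<mapsto> - x\<close>,
  \<open>f \<mapsto> (\<lambda>t. - f (- t))\<close>, an exchange that swaps the two one-sided conditions at \<open>0\<close>. So it
  suffices to exclude a solution that is positive throughout, by means of the condition on the
  left of \<open>0\<close>.

  Since \<open>f\<close> has the sign of its argument and \<open>c < 1\<close>, a positive solution that once fails to
  increase decreases from then on (\<open>positive_solution_descent_persists\<close>). Hence it is eventually
  monotone. If it converges, its limit \<open>L\<close> satisfies \<open>L = c * L + f 0 = c * L\<close>, so \<open>L = 0\<close>.

  An increasing positive solution is therefore unbounded; but \<open>f t \<le> t + M\<close> for \<open>t \<ge> 0\<close>, so its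
  increments \<open>d\<close> satisfy \<open>d' \<le> d + M - (1 - c) * x\<close> and would in the end drop by at
  least \<open>1\<close> at each step (\<open>no_increasing_positive_solution\<close>).

  A decreasing positive solution tends to \<open>0\<close>, so its increments approach \<open>0\<close> from the left,
  where \<open>f t \<le> \<beta> * t\<close> for any \<open>\<beta> < \<alpha>\<^sub>1\<close>, in particular for one still within the open
  interval to which \<open>\<alpha>\<^sub>1\<close> is confined. The solution is thus dominated by the linear recurrence
  with characteristic polynomial \<open>r\<^sup>2 - (c + \<beta>) * r + \<beta>\<close>. The bounds \<open>(1 \<plusminus> sqrt (1 - c))\<^sup>2\<close>
  are precisely the values of \<open>\<beta>\<close> at which its discriminant vanishes; between them there is no
  real characteristic root, and the successive quotients of the solution would decrease below
  every bound (\<open>no_positive_seq_below_complex_recurrence\<close>).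
\<close>

section \<open>Sign-preserving functions of at most linear growth\<close>

lemma eventually_at_left_less_zero: "\<forall>\<^sub>F t::real in at_left 0. t < 0"
  by (simp add: eventually_at_filter)

lemma sign_preserving_at_zero:
  fixes f :: "real \<Rightarrow> real"
  assumes cont: "isCont f 0" and sign: "\<And>t. t * f t \<ge> 0"
  shows "f 0 = 0"
proof (rule antisym)
  have "(f \<longlongrightarrow> f 0) (at_left 0)" "(f \<longlongrightarrow> f 0) (at_right 0)"
    using cont by (auto simp: isCont_def filterlim_at_split)
  moreover have "\<forall>\<^sub>F t in at_left 0. f t \<le> 0"
    using eventually_at_left_less_zero
    by eventually_elim (use sign in \<open>auto simp: zero_le_mult_iff not_le[symmetric]\<close>)
  moreover have "\<forall>\<^sub>F t in at_right 0. f t \<ge> 0"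
    using eventually_at_right_less[of "0::real"]
    by eventually_elim (use sign in \<open>auto simp: zero_le_mult_iff not_le[symmetric]\<close>)
  ultimately show "f 0 \<le> 0" "f 0 \<ge> 0"
    by (auto intro: tendsto_upperbound tendsto_lowerbound)
qed

lemma linear_growth_imp_affine_bound:
  fixes f :: "real \<Rightarrow> real"
  assumes cont: "continuous_on UNIV f"
    and growth: "\<exists>a t\<^sub>0. a \<le> 1 \<and> t\<^sub>0 > 0 \<and> (\<forall>t. \<bar>t\<bar> \<ge> t\<^sub>0 \<longrightarrow> \<bar>f t\<bar> \<le> a * \<bar>t\<bar>)"
  obtains M where "\<And>t. t \<ge> 0 \<Longrightarrow> f t \<le> t + M"
proof -
  obtain a t0 where a: "a \<le> 1" and t0: "t0 > 0"
    and large: "\<And>t. \<bar>t\<bar> \<ge> t0 \<Longrightarrow> \<bar>f t\<bar> \<le> a * \<bar>t\<bar>"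
    using growth by blast
  have "\<forall>t. 0 \<le> t \<and> t \<le> t0 \<longrightarrow> isCont f t"
    using cont by (simp add: continuous_on_eq_continuous_at)
  then obtain K where K: "\<And>t. 0 \<le> t \<Longrightarrow> t \<le> t0 \<Longrightarrow> f t \<le> K"
    using isCont_bounded[of 0 t0 f] t0 by auto
  have "f t \<le> t + max 0 K" if "t \<ge> 0" for t
  proof (cases "t \<le> t0")
    case True
    with K[of t] that show ?thesis by simp
  next
    case False
    have "f t \<le> a * t" using large[of t] False that by auto
    also have "\<dots> \<le> t" using mult_right_mono[OF a that] by simp
    finally show ?thesis by simp
  qed
  with that show ?thesis by blast
qed

section \<open>Transformations and limits of solutions\<close>

lemma solution_shift:
  assumes "solution c f x"
  shows "solution c f (\<lambda>n. x (n + k))"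
  unfolding solution_def
proof (intro allI impI)
  fix n :: nat
  assume "n \<ge> 1"
  then have "x (n + k + 1) = c * x (n + k) + f (x (n + k) - x (n + k - 1))"
    using assms unfolding solution_def by simp
  with \<open>n \<ge> 1\<close> show "x (n + 1 + k) = c * x (n + k) + f (x (n + k) - x (n - 1 + k))"
    by (simp add: add_ac)
qed

lemma solution_reflect:
  assumes "solution c f x"
  shows "solution c (\<lambda>t. - f (- t)) (\<lambda>n. - x n)"
  using assms by (simp add: solution_def)

lemma solution_Suc_Suc:
  assumes "solution c f x"
  shows "x (Suc (Suc n)) = c * x (Suc n) + f (x (Suc n) - x n)"
  using assms[unfolded solution_def, rule_format, of "Suc n"] by simp

lemma solution_limit_eq_zero:
  assumes sol: "solution c f x" and "c < 1"
    and cont: "isCont f 0" and f0: "f 0 = 0" and lim: "x \<longlonglongrightarrow> L"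
  shows "L = 0"
proof -
  have lim1: "(\<lambda>n. x (Suc n)) \<longlonglongrightarrow> L" using lim by (rule LIMSEQ_Suc)
  then have lim2: "(\<lambda>n. x (Suc (Suc n))) \<longlonglongrightarrow> L" by (rule LIMSEQ_Suc)
  have "(\<lambda>n. x (Suc n) - x n) \<longlonglongrightarrow> 0"
    using tendsto_diff[OF lim1 lim] by simp
  from isCont_tendsto_compose[OF cont this]
  have "(\<lambda>n. f (x (Suc n) - x n)) \<longlonglongrightarrow> 0" by (simp add: f0)
  from tendsto_add[OF tendsto_mult[OF tendsto_const lim1] this]
  have "(\<lambda>n. x (Suc (Suc n))) \<longlonglongrightarrow> c * L"
    by (simp add: solution_Suc_Suc[OF sol])
  with lim2 have "L = c * L" by (rule LIMSEQ_unique)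
  with \<open>c < 1\<close> show ?thesis by simp
qed

section \<open>Positive solutions\<close>

text \<open>
  After a step that is not upward, \<open>f\<close> contributes nothing positive, and \<open>c * x \<le> x\<close> makes the
  next step not upward either.
\<close>

lemma positive_solution_descent_persists:
  assumes sol: "solution c f x" and "c < 1" and sign: "\<And>t. t * f t \<ge> 0" and f0: "f 0 = 0"
    and pos: "\<And>n. x n > 0" and descent: "x (Suc n) \<le> x n"
  shows "x (Suc (Suc n)) \<le> x (Suc n)"
proof -
  have "f (x (Suc n) - x n) \<le> 0"
    using sign[of "x (Suc n) - x n"] descent f0 by (auto simp: zero_le_mult_iff)
  moreover have "c * x (Suc n) \<le> x (Suc n)"
    using mult_right_mono[of c 1 "x (Suc n)"] \<open>c < 1\<close> pos[of "Suc n"] by simp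
  ultimately show ?thesis using solution_Suc_Suc[OF sol, of n] by simp
qed

lemma no_increasing_positive_solution:
  assumes sol: "solution c f x" and c: "c < 1"
    and cont: "isCont f 0" and f0: "f 0 = 0"
    and bound: "\<And>t. t \<ge> 0 \<Longrightarrow> f t \<le> t + M"
    and pos: "\<And>n. x n > 0" and inc: "incseq x"
  shows False
proof (cases "bdd_above (range x)")
  case True
  then have lim: "x \<longlonglongrightarrow> (SUP n. x n)" using inc by (rule LIMSEQ_incseq_SUP)
  from solution_limit_eq_zero[OF sol c cont f0 this] have "(SUP n. x n) = 0" .
  with incseq_le[OF inc lim, of 0] pos[of 0] show False by simp
next
  case False
  \<comment> \<open>Beyond the level \<open>(M + 1) / (1 - c)\<close> the term \<open>- (1 - c) * x\<close> in the increment
    outweighs \<open>M\<close> by at least \<open>1\<close>.\<close>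
  from False obtain N where N: "x N > (M + 1) / (1 - c)"
    by (auto simp: bdd_above_def not_le)
  define d where "d n = x (Suc (N + n)) - x (N + n)" for n
  have d_nonneg: "d n \<ge> 0" for n
    using incseq_SucD[OF inc, of "N + n"] by (simp add: d_def)
  have step: "d (Suc n) \<le> d n - 1" for n
  proof -
    have "x N \<le> x (Suc (N + n))" using inc by (simp add: incseq_def)
    with N have "(M + 1) / (1 - c) \<le> x (Suc (N + n))" by simp
    then have "M + 1 \<le> (1 - c) * x (Suc (N + n))"
      using c by (simp add: field_simps)
    moreover have "d (Suc n) = f (d n) - (1 - c) * x (Suc (N + n))"
      using solution_Suc_Suc[OF sol, of "N + n"] by (simp add: d_def algebra_simps)
    ultimately show ?thesis using bound[OF d_nonneg[of n]] by simp
  qed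
  have "d n \<le> d 0 - real n" for n
  proof (induction n)
    case (Suc n)
    with step[of n] show ?case by simp
  qed simp
  moreover obtain n where "real n > d 0" using reals_Archimedean2 by blast
  ultimately show False using d_nonneg[of n] by (metis diff_less_0_iff_less not_le order_trans)
qed

text \<open>
  The hypothesis on the coefficients says that the characteristic polynomial
  \<open>r\<^sup>2 - (c + \<beta>) * r + \<beta>\<close> is bounded below by some \<open>\<delta> > 0\<close>. The quotients \<open>r\<close> of successive
  terms obey \<open>r' \<le> (c + \<beta>) - \<beta> / r\<close>, hence \<open>r' - r \<le> - \<delta> / r \<le> - \<delta>\<close> because \<open>0 < r \<le> 1\<close>;
  so they cannot stay positive.
\<close>

lemma no_positive_seq_below_complex_recurrence:
  fixes x :: "nat \<Rightarrow> real"
  assumes disc: "(c + \<beta>)\<^sup>2 < 4 * \<beta>"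
    and pos: "\<And>n. x n > 0" and dec: "\<And>n. x (Suc n) \<le> x n"
    and rec: "\<And>n. x (Suc (Suc n)) \<le> c * x (Suc n) + \<beta> * (x (Suc n) - x n)"
  shows False
proof -
  define \<delta> where "\<delta> = \<beta> - (c + \<beta>)\<^sup>2 / 4"
  have \<delta>: "\<delta> > 0" using disc by (simp add: \<delta>_def)
  define r where "r n = x (Suc n) / x n" for n
  have r_pos: "r n > 0" for n using pos by (simp add: r_def)
  have r_le1: "r n \<le> 1" for n using pos dec by (simp add: r_def)
  have step: "r (Suc n) \<le> r n - \<delta>" for n
  proof -
    have xr: "x (Suc n) = r n * x n" "x (Suc (Suc n)) = r (Suc n) * (r n * x n)"
      using pos[of n] pos[of "Suc n"] by (simp_all add: r_def)
    have "(r (Suc n) * r n) * x n \<le> ((c + \<beta>) * r n - \<beta>) * x n"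
      using rec[of n] unfolding xr by (simp add: algebra_simps)
    then have "r (Suc n) * r n \<le> (c + \<beta>) * r n - \<beta>"
      using pos[of n] by (simp only: mult_le_cancel_right_pos)
    also have "\<dots> = r n * r n - (r n - (c + \<beta>) / 2)\<^sup>2 - \<delta>"
      by (simp add: \<delta>_def power2_eq_square field_simps)
    also have "\<dots> \<le> r n * r n - \<delta>" by simp
    also have "\<dots> \<le> r n * r n - \<delta> * r n"
      using mult_left_mono[OF r_le1[of n], of \<delta>] \<delta> by simp
    also have "\<dots> = (r n - \<delta>) * r n" by (simp add: algebra_simps)
    finally show ?thesis using r_pos[of n] by (simp only: mult_le_cancel_right_pos)
  qed
  have "r n \<le> r 0 - real n * \<delta>" for n
  proof (induction n)
    case (Suc n)
    with step[of n] show ?case by (simp add: algebra_simps)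
  qed simp
  moreover obtain n where "real n * \<delta> > r 0" using reals_Archimedean3[OF \<delta>] by blast
  ultimately show False using r_pos[of n] by (metis diff_less_0_iff_less less_le_trans not_less_iff_gr_or_eq)
qed

lemma no_decreasing_positive_solution:
  assumes sol: "solution c f x" and c: "c < 1"
    and cont: "isCont f 0" and f0: "f 0 = 0"
    and left: "\<forall>\<^sub>F t in at_left 0. f t \<le> \<beta> * t" and disc: "(c + \<beta>)\<^sup>2 < 4 * \<beta>"
    and pos: "\<And>n. x n > 0" and dec: "\<And>n. x (Suc n) \<le> x n"
  shows False
proof -
  have "\<And>n. 0 \<le> x n" using pos by (simp add: less_imp_le)
  then obtain L where lim: "x \<longlonglongrightarrow> L"
    using decseq_convergent[of x 0] dec by (metis decseq_Suc_iff)
  with solution_limit_eq_zero[OF sol c cont f0 lim] have lim0: "x \<longlonglongrightarrow> 0" by simp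
  obtain e where e: "e < 0" "\<And>t. e < t \<Longrightarrow> t < 0 \<Longrightarrow> f t \<le> \<beta> * t"
    using left by (auto simp: eventually_at_left_field)
  have "(\<lambda>n. x (Suc n) - x n) \<longlonglongrightarrow> 0 - 0"
    using lim0 by (intro tendsto_diff) (simp_all add: filterlim_sequentially_Suc)
  then have "\<forall>\<^sub>F n in sequentially. e < x (Suc n) - x n"
    using e(1) by (intro order_tendstoD(1)) simp_all
  then obtain N where N: "\<And>n. n \<ge> N \<Longrightarrow> e < x (Suc n) - x n"
    by (auto simp: eventually_sequentially)
  have f_le: "f (x (Suc n) - x n) \<le> \<beta> * (x (Suc n) - x n)" if "n \<ge> N" for n
  proof (cases "x (Suc n) = x n")
    case True
    then show ?thesis by (simp add: f0)
  next
    case False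
    with dec[of n] have "x (Suc n) - x n < 0" by simp
    then show ?thesis using e(2) N[OF that] by blast
  qed
  show False
  proof (rule no_positive_seq_below_complex_recurrence[OF disc, of "\<lambda>n. x (n + N)"])
    show "x (Suc (Suc n) + N) \<le> c * x (Suc n + N) + \<beta> * (x (Suc n + N) - x (n + N))" for n
      using f_le[of "n + N"] solution_Suc_Suc[OF sol, of "n + N"] by simp
  qed (use pos dec in simp_all)
qed

lemma no_eventually_positive_solution:
  fixes f :: "real \<Rightarrow> real"
  assumes c: "c < 1"
    and cont: "continuous_on UNIV f" and sign: "\<And>t. t * f t \<ge> 0"
    and growth: "\<exists>a t\<^sub>0. a \<le> 1 \<and> t\<^sub>0 > 0 \<and> (\<forall>t. \<bar>t\<bar> \<ge> t\<^sub>0 \<longrightarrow> \<bar>f t\<bar> \<le> a * \<bar>t\<bar>)"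
    and left: "\<forall>\<^sub>F t in at_left 0. f t \<le> \<beta> * t" and disc: "(c + \<beta>)\<^sup>2 < 4 * \<beta>"
    and sol: "solution c f x"
  shows "\<not> eventually_positive x"
proof
  assume "eventually_positive x"
  then obtain N where N: "\<And>n. n \<ge> N \<Longrightarrow> x n > 0"
    by (auto simp: eventually_positive_def eventually_sequentially)
  define y where "y n = x (n + N)" for n
  have sol_y: "solution c f y" using solution_shift[OF sol, of N] unfolding y_def .
  have pos_y: "y n > 0" for n using N by (simp add: y_def)
  have cont0: "isCont f 0" using cont by (simp add: continuous_on_eq_continuous_at)
  have f0: "f 0 = 0" by (rule sign_preserving_at_zero[OF cont0 sign])
  obtain M where M: "\<And>t. t \<ge> 0 \<Longrightarrow> f t \<le> t + M"
    using linear_growth_imp_affine_bound[OF cont growth] by blast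
  show False
  proof (cases "\<exists>k. y (Suc k) \<le> y k")
    case False
    then have "incseq y" by (auto simp: incseq_Suc_iff not_le less_imp_le)
    with no_increasing_positive_solution[OF sol_y c cont0 f0 M pos_y] show False by blast
  next
    case True
    then obtain k where k: "y (Suc k) \<le> y k" ..
    have "y (Suc n + k) \<le> y (n + k)" for n
    proof (induction n)
      case (Suc n)
      then show ?case
        using positive_solution_descent_persists[OF sol_y c sign f0 pos_y, of "n + k"] by simp
    qed (use k in simp)
    with no_decreasing_positive_solution[OF solution_shift[OF sol_y, of k] c cont0 f0 left disc]
    show False using pos_y by simp
  qed
qed

section \<open>The admissible slopes and oscillation\<close>

text \<open>
  The discriminant \<open>(c + \<beta>)\<^sup>2 - 4 * \<beta>\<close> factors over \<open>\<beta>\<close> into the two linear terms that vanish at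
  the ends of the interval.
\<close>

lemma discriminant_neg:
  fixes c \<beta> :: real
  assumes "c < 1" and "(1 - sqrt (1 - c))\<^sup>2 < \<beta>" and "\<beta> < (1 + sqrt (1 - c))\<^sup>2"
  shows "(c + \<beta>)\<^sup>2 < 4 * \<beta>"
proof -
  define s where "s = sqrt (1 - c)"
  have c: "c = 1 - s\<^sup>2" using \<open>c < 1\<close> by (simp add: s_def)
  have "(c + \<beta>)\<^sup>2 - 4 * \<beta> = (\<beta> - (1 - s)\<^sup>2) * (\<beta> - (1 + s)\<^sup>2)"
    by (simp add: c power2_eq_square algebra_simps)
  also have "\<dots> < 0" using assms(2,3) by (simp add: s_def mult_pos_neg)
  finally show ?thesis by simp
qed

text \<open>
  A lower limit of at least \<open>\<alpha>\<close> need not bound \<open>f t / t\<close> by \<open>\<alpha>\<close> itself, only by each smaller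
  number; the open condition on \<open>\<alpha>\<close> leaves room for one.
\<close>

lemma slope_below_Liminf:
  fixes f :: "real \<Rightarrow> real"
  assumes lim: "Liminf F (\<lambda>t. ereal (f t / t)) \<ge> ereal \<alpha>" and "c < 1"
    and lower: "(1 - sqrt (1 - c))\<^sup>2 < \<alpha>" and upper: "\<alpha> < (1 + sqrt (1 - c))\<^sup>2"
  obtains \<beta> where "(c + \<beta>)\<^sup>2 < 4 * \<beta>" and "\<forall>\<^sub>F t in F. \<beta> < f t / t"
proof -
  obtain \<beta> where \<beta>: "(1 - sqrt (1 - c))\<^sup>2 < \<beta>" "\<beta> < \<alpha>" using dense[OF lower] by blast
  have "(c + \<beta>)\<^sup>2 < 4 * \<beta>" using discriminant_neg[OF \<open>c < 1\<close>] \<beta> upper by simp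
  moreover have "\<forall>\<^sub>F t in F. ereal \<beta> < ereal (f t / t)"
    using lim[unfolded le_Liminf_iff, rule_format, of "ereal \<beta>"] \<beta>(2) by simp
  then have "\<forall>\<^sub>F t in F. \<beta> < f t / t" by simp
  ultimately show ?thesis using that by blast
qed

theorem theorem3p3:
  fixes c \<alpha>\<^sub>1 \<alpha>\<^sub>2 :: real and f :: "real \<Rightarrow> real"
  assumes "0 \<le> c" and "c < 1"
    and "continuous_on UNIV f"
    and "\<And>t. t * f t \<ge> 0"
    and "\<exists>a t\<^sub>0. a \<le> 1 \<and> t\<^sub>0 > 0 \<and> (\<forall>t. \<bar>t\<bar> \<ge> t\<^sub>0 \<longrightarrow> \<bar>f t\<bar> \<le> a * \<bar>t\<bar>)"
    and "\<alpha>\<^sub>1 > 0" and "\<alpha>\<^sub>2 > 0"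
    and "Liminf (at_left 0) (\<lambda>t. ereal (f t / t)) \<ge> ereal \<alpha>\<^sub>1"
    and "Liminf (at_right 0) (\<lambda>t. ereal (f t / t)) \<ge> ereal \<alpha>\<^sub>2"
    and "(1 - sqrt (1 - c))\<^sup>2 < \<alpha>\<^sub>1" and "\<alpha>\<^sub>1 < (1 + sqrt (1 - c))\<^sup>2"
    and "(1 - sqrt (1 - c))\<^sup>2 < \<alpha>\<^sub>2" and "\<alpha>\<^sub>2 < (1 + sqrt (1 - c))\<^sup>2"
  shows "oscillatory_equation c f"
proof -
  note c = \<open>c < 1\<close> and cont = assms(3) and sign = assms(4) and growth = assms(5)
  obtain \<beta>1 where disc1: "(c + \<beta>1)\<^sup>2 < 4 * \<beta>1"
    and slope1: "\<forall>\<^sub>F t in at_left 0. \<beta>1 < f t / t"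
    using slope_below_Liminf[OF assms(8) c assms(10,11)] .
  obtain \<beta>2 where disc2: "(c + \<beta>2)\<^sup>2 < 4 * \<beta>2"
    and slope2: "\<forall>\<^sub>F t in at_right 0. \<beta>2 < f t / t"
    using slope_below_Liminf[OF assms(9) c assms(12,13)] .
  have left: "\<forall>\<^sub>F t in at_left 0. f t \<le> \<beta>1 * t"
    using slope1 eventually_at_left_less_zero
    by eventually_elim (simp add: field_simps)
  have "\<forall>\<^sub>F t in at_right 0. \<beta>2 * t \<le> f t"
    using slope2 eventually_at_right_less[of "0::real"]
    by eventually_elim (simp add: field_simps)
  then have right: "\<forall>\<^sub>F t in at_left 0. - f (- t) \<le> \<beta>2 * t"
    by (simp add: at_left_minus eventually_filtermap)
  have cont': "continuous_on UNIV (\<lambda>t. - f (- t))"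
    by (intro continuous_intros continuous_on_compose2[OF cont]) auto
  have sign': "t * (- f (- t)) \<ge> 0" for t using sign[of "- t"] by simp
  have growth': "\<exists>a t\<^sub>0. a \<le> 1 \<and> t\<^sub>0 > 0 \<and> (\<forall>t. \<bar>t\<bar> \<ge> t\<^sub>0 \<longrightarrow> \<bar>- f (- t)\<bar> \<le> a * \<bar>t\<bar>)"
    using growth by (metis abs_minus_cancel)
  show ?thesis
    unfolding oscillatory_equation_def
  proof (intro allI impI conjI)
    fix x
    assume sol: "solution c f x"
    show "\<not> eventually_positive x"
      by (rule no_eventually_positive_solution[OF c cont sign growth left disc1 sol])
    have "\<not> eventually_positive (\<lambda>n. - x n)"
      by (rule no_eventually_positive_solution
          [OF c cont' sign' growth' right disc2 solution_reflect[OF sol]])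
    then show "\<not> eventually_negative x"
      by (simp add: eventually_positive_def eventually_negative_def)
  qed
qed

end
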